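(* Let $L$ be a Lie-Yamaguti algebra and $(\rho,D,\theta;V)$ a representation of $L$. Then there are isomorphisms of groups $$\mathrm{Aut}^L_V(L \ltimes V) \cong \mathrm{Aut}_{\mathrm{rep}}(V) \ltimes \mathrm{Aut}^{V,L}(L \ltimes V),\qquad \mathrm{Aut}^V(L\ltimes V) \cong \mathrm{Aut}^{\mathrm{inv}}(L) \ltimes \mathrm{Aut}^{V,L}(L \ltimes V),$$ where on the right-hand sides $\ltimes$ denotes a semi-direct product of groups with normal factor $\mathrm{Aut}^{V,L}(L\ltimes V)$, for suitable actions of $\mathrm{Aut}_{\mathrm{rep}}(V)$ and $\mathrm{Aut}^{\mathrm{inv}}(L)$ on $\mathrm{Aut}^{V,L}(L\ltimes V)$ by group automorphisms.
   Context: All vector spaces are over a field $\mathbb{K}$ of characteristic zero. A Lie-Yamaguti algebra is a vector space $L$ with a bilinear operation $[\cdot,\cdot]$ and a trilinear operation $\{\cdot,\cdot,\cdot\}$ such that for all $a,b,c,x,y,z$: (LY1) $[a,b]=-[b,a]$; (LY2) $\{a,b,c\}=-\{b,a,c\}$; (LY3) $[[a,b],c]+\{a,b,c\}+[[b,c],a]+\{b,c,a\}+[[c,a],b]+\{c,a,b\}=0$; (LY4) $\{[a,b],c,x\}+\{[b,c],a,x\}+\{[c,a],b,x\}=0$; (LY5) $\{a,b,[x,y]\}=[\{a,b,x\},y]+[x,\{a,b,y\}]$; (LY6) $\{a,b,\{x,y,z\}\}=\{\{a,b,x\},y,z\}+\{x,\{a,b,y\},z\}+\{x,y,\{a,b,z\}\}$.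 Morphisms are linear maps preserving both operations; $\mathrm{Aut}$ denotes the group of bijective self-morphisms. A representation $(\rho,D,\theta;V)$ of $L$ on a vector space $V$ consists of a linear map $\rho:L\to\mathrm{End}(V)$ and bilinear maps $D,\theta:L\times L\to\mathrm{End}(V)$ such that for all $a,b,c,d\in L$: $D(a,b)+\theta(a,b)-\theta(b,a)=[\rho(a),\rho(b)]-\rho([a,b])$; $\theta(a,[b,c])-\rho(b)\theta(a,c)+\rho(c)\theta(a,b)=0$; $\theta([a,b],c)-\theta(a,c)\rho(b)+\theta(b,c)\rho(a)=0$; $\theta(c,d)\theta(a,b)-\theta(b,d)\theta(a,c)-\theta(a,\{b,c,d\})+D(b,c)\theta(a,d)=0$; $[D(a,b),\rho(c)]=\rho(\{a,b,c\})$; $[D(a,b),\theta(c,d)]=\theta(\{a,b,c\},d)+\theta(c,\{a,b,d\})$. The semi-direct product Lie-Yamaguti algebra $L\ltimes V$ is the vector space $L\oplus V$ with $[a+u,b+v]_\ltimes=[a,b]+\rho(a)(v)-\rho(b)(u)$ and $\{a+u,b+v,c+w\}_\ltimes=\{a,b,c\}+D(a,b)(w)+\theta(b,c)(u)-\theta(a,c)(v)$. $V$ is an abelian ideal of it; $p:L\ltimes V\to L$ is the projection and $s:L\to L\ltimes V$, $s(a)=(a,0)$. $\mathrm{Aut}_V(L\ltimes V)$ is the group of $\gamma\in\mathrm{Aut}(L\ltimes V)$ with $\gamma(V)=V$; for such $\gamma$ put $\bar\gamma=p\gamma s\in\mathrm{Aut}(L)$. Then $\mathrm{Aut}_V^L(L\ltimes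 V)=\{\gamma\in\mathrm{Aut}_V(L\ltimes V):\bar\gamma=\mathrm{id}_L\}$, $\mathrm{Aut}^V(L\ltimes V)=\{\gamma\in\mathrm{Aut}_V(L\ltimes V):\gamma|_V=\mathrm{id}_V\}$, and $\mathrm{Aut}^{V,L}(L\ltimes V)$ is their intersection. $\mathrm{Aut}_{\mathrm{rep}}(V)$ is the group of linear automorphisms $\phi$ of $V$ commuting with all $\rho(a)$, $D(a,b)$, $\theta(a,b)$, $a,b\in L$. $\mathrm{Aut}^{\mathrm{inv}}(L)$ is the group of $\psi\in\mathrm{Aut}(L)$ with $\rho(\psi(a))=\rho(a)$, $D(\psi(a),\psi(b))=D(a,b)$, $\theta(\psi(a),\psi(b))=\theta(a,b)$ for all $a,b\in L$. *)

theory Defs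
  imports Complex_Main "HOL-Library.Product_Plus" "HOL-Algebra.Bij"
begin

definition bilinear_map ::
  "('k::field \<Rightarrow> 'a::ab_group_add \<Rightarrow> 'a) \<Rightarrow> ('k \<Rightarrow> 'b::ab_group_add \<Rightarrow> 'b) \<Rightarrow>
   ('k \<Rightarrow> 'c::ab_group_add \<Rightarrow> 'c) \<Rightarrow> ('a \<Rightarrow> 'b \<Rightarrow> 'c) \<Rightarrow> bool" where
  "bilinear_map s1 s2 s3 f \<longleftrightarrow>
     (\<forall>x. Vector_Spaces.linear s2 s3 (\<lambda>y. f x y)) \<and>
     (\<forall>y. Vector_Spaces.linear s1 s3 (\<lambda>x. f x y))"

definition trilinear_map ::
  "('k::field \<Rightarrow> 'a::ab_group_add \<Rightarrow> 'a) \<Rightarrow> ('k \<Rightarrow> 'b::ab_group_add \<Rightarrow> 'b) \<Rightarrow>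
   ('k \<Rightarrow> 'c::ab_group_add \<Rightarrow> 'c) \<Rightarrow> ('k \<Rightarrow> 'd::ab_group_add \<Rightarrow> 'd) \<Rightarrow>
   ('a \<Rightarrow> 'b \<Rightarrow> 'c \<Rightarrow> 'd) \<Rightarrow> bool" where
  "trilinear_map s1 s2 s3 s4 f \<longleftrightarrow>
     (\<forall>x y. Vector_Spaces.linear s3 s4 (\<lambda>z. f x y z)) \<and>
     (\<forall>x z. Vector_Spaces.linear s2 s4 (\<lambda>y. f x y z)) \<and>
     (\<forall>y z. Vector_Spaces.linear s1 s4 (\<lambda>x. f x y z))"

locale lie_yamaguti_algebra = vector_space scale
  for scale :: "'k::field_char_0 \<Rightarrow> 'l::ab_group_add \<Rightarrow> 'l" +
  fixes br :: "'l \<Rightarrow> 'l \<Rightarrow> 'l"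
    and tr :: "'l \<Rightarrow> 'l \<Rightarrow> 'l \<Rightarrow> 'l"
  assumes br_bilinear: "bilinear_map scale scale scale br"
    and tr_trilinear: "trilinear_map scale scale scale scale tr"
    and LY1: "br a b = - br b a"
    and LY2: "tr a b c = - tr b a c"
    and LY3: "br (br a b) c + tr a b c + br (br b c) a + tr b c a + br (br c a) b + tr c a b = 0"
    and LY4: "tr (br a b) c x + tr (br b c) a x + tr (br c a) b x = 0"
    and LY5: "tr a b (br x y) = br (tr a b x) y + br x (tr a b y)"
    and LY6: "tr a b (tr x y z) = tr (tr a b x) y z + tr x (tr a b y) z + tr x y (tr a b z)"

text \<open>Linear maps into \<open>End(V)\<close> are curried: linearity of \<open>\<rho> : L \<rightarrow> End(V)\<close>
  together with linearity of every \<open>\<rho>(a)\<close> is bilinearity of \<open>(a, v) \<mapsto> \<rho>(a)(v)\<close>,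
  and similarly for \<open>D\<close> and \<open>\<theta>\<close>. Identities in \<open>End(V)\<close> are evaluated at \<open>v\<close>.\<close>

locale ly_representation =
  L: lie_yamaguti_algebra scaleL br tr + V: vector_space scaleV
  for scaleL :: "'k::field_char_0 \<Rightarrow> 'l::ab_group_add \<Rightarrow> 'l"
    and br :: "'l \<Rightarrow> 'l \<Rightarrow> 'l"
    and tr :: "'l \<Rightarrow> 'l \<Rightarrow> 'l \<Rightarrow> 'l"
    and scaleV :: "'k \<Rightarrow> 'v::ab_group_add \<Rightarrow> 'v" +
  fixes \<rho> :: "'l \<Rightarrow> 'v \<Rightarrow> 'v"
    and D :: "'l \<Rightarrow> 'l \<Rightarrow> 'v \<Rightarrow> 'v"
    and \<theta> :: "'l \<Rightarrow> 'l \<Rightarrow> 'v \<Rightarrow> 'v"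
  assumes rho_linear: "bilinear_map scaleL scaleV scaleV \<rho>"
    and D_bilinear: "trilinear_map scaleL scaleL scaleV scaleV D"
    and theta_bilinear: "trilinear_map scaleL scaleL scaleV scaleV \<theta>"
    and rep1: "D a b v + \<theta> a b v - \<theta> b a v = (\<rho> a (\<rho> b v) - \<rho> b (\<rho> a v)) - \<rho> (br a b) v"
    and rep2: "\<theta> a (br b c) v - \<rho> b (\<theta> a c v) + \<rho> c (\<theta> a b v) = 0"
    and rep3: "\<theta> (br a b) c v - \<theta> a c (\<rho> b v) + \<theta> b c (\<rho> a v) = 0"
    and rep4: "\<theta> c d (\<theta> a b v) - \<theta> b d (\<theta> a c v) - \<theta> a (tr b c d) v + D b c (\<theta> a d v) = 0"
    and rep5: "D a b (\<rho> c v) - \<rho> c (D a b v) = \<rho> (tr a b c) v"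
    and rep6: "D a b (\<theta> c d v) - \<theta> c d (D a b v) = \<theta> (tr a b c) d v + \<theta> c (tr a b d) v"

definition ly_aut ::
  "('k::field \<Rightarrow> 'l::ab_group_add \<Rightarrow> 'l) \<Rightarrow> ('l \<Rightarrow> 'l \<Rightarrow> 'l) \<Rightarrow> ('l \<Rightarrow> 'l \<Rightarrow> 'l \<Rightarrow> 'l) \<Rightarrow>
   ('l \<Rightarrow> 'l) set" where
  "ly_aut scale br tr =
     {f. bij f \<and> Vector_Spaces.linear scale scale f \<and>
         (\<forall>a b. f (br a b) = br (f a) (f b)) \<and>
         (\<forall>a b c. f (tr a b c) = tr (f a) (f b) (f c))}"

definition sd_scale ::
  "('k \<Rightarrow> 'l \<Rightarrow> 'l) \<Rightarrow> ('k \<Rightarrow> 'v \<Rightarrow> 'v) \<Rightarrow> 'k \<Rightarrow> 'l \<times> 'v \<Rightarrow> 'l \<times> 'v" where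
  "sd_scale scaleL scaleV k = (\<lambda>(a, u). (scaleL k a, scaleV k u))"

definition sd_br ::
  "('l \<Rightarrow> 'l \<Rightarrow> 'l) \<Rightarrow> ('l \<Rightarrow> 'v \<Rightarrow> 'v::ab_group_add) \<Rightarrow> 'l \<times> 'v \<Rightarrow> 'l \<times> 'v \<Rightarrow> 'l \<times> 'v" where
  "sd_br br \<rho> = (\<lambda>(a, u) (b, v). (br a b, \<rho> a v - \<rho> b u))"

definition sd_tr ::
  "('l \<Rightarrow> 'l \<Rightarrow> 'l \<Rightarrow> 'l) \<Rightarrow> ('l \<Rightarrow> 'l \<Rightarrow> 'v \<Rightarrow> 'v) \<Rightarrow> ('l \<Rightarrow> 'l \<Rightarrow> 'v \<Rightarrow> 'v::ab_group_add) \<Rightarrow>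
   'l \<times> 'v \<Rightarrow> 'l \<times> 'v \<Rightarrow> 'l \<times> 'v \<Rightarrow> 'l \<times> 'v" where
  "sd_tr tr D \<theta> = (\<lambda>(a, u) (b, v) (c, w). (tr a b c, D a b w + \<theta> b c u - \<theta> a c v))"

definition V_part :: "('l::zero \<times> 'v) set" where
  "V_part = {0} \<times> UNIV"

text \<open>\<open>bar \<gamma> = p \<gamma> s\<close> for the projection \<open>p = fst\<close> and the section \<open>s a = (a, 0)\<close>.\<close>

definition bar :: "('l \<times> 'v \<Rightarrow> 'l \<times> 'v::zero) \<Rightarrow> 'l \<Rightarrow> 'l" where
  "bar \<gamma> = fst \<circ> \<gamma> \<circ> (\<lambda>a. (a, 0))"

context
  fixes scaleL :: "'k::field_char_0 \<Rightarrow> 'l::ab_group_add \<Rightarrow> 'l"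
    and br :: "'l \<Rightarrow> 'l \<Rightarrow> 'l"
    and tr :: "'l \<Rightarrow> 'l \<Rightarrow> 'l \<Rightarrow> 'l"
    and scaleV :: "'k \<Rightarrow> 'v::ab_group_add \<Rightarrow> 'v"
    and \<rho> :: "'l \<Rightarrow> 'v \<Rightarrow> 'v"
    and D :: "'l \<Rightarrow> 'l \<Rightarrow> 'v \<Rightarrow> 'v"
    and \<theta> :: "'l \<Rightarrow> 'l \<Rightarrow> 'v \<Rightarrow> 'v"
begin

definition Aut_V :: "('l \<times> 'v \<Rightarrow> 'l \<times> 'v) set" where
  "Aut_V = {\<gamma> \<in> ly_aut (sd_scale scaleL scaleV) (sd_br br \<rho>) (sd_tr tr D \<theta>).
              \<gamma> ` V_part = V_part}"

text \<open>In the names below, \<open>_over_L\<close> means inducing the identity on \<open>L\<close> (upper index \<open>L\<close>)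
  and \<open>_fix_V\<close> means restricting to the identity on \<open>V\<close> (upper index \<open>V\<close>).\<close>

definition Aut_V_over_L :: "('l \<times> 'v \<Rightarrow> 'l \<times> 'v) set" where
  "Aut_V_over_L = {\<gamma> \<in> Aut_V. bar \<gamma> = id}"

definition Aut_fix_V :: "('l \<times> 'v \<Rightarrow> 'l \<times> 'v) set" where
  "Aut_fix_V = {\<gamma> \<in> Aut_V. \<forall>x \<in> V_part. \<gamma> x = x}"

definition Aut_fix_V_over_L :: "('l \<times> 'v \<Rightarrow> 'l \<times> 'v) set" where
  "Aut_fix_V_over_L = Aut_fix_V \<inter> Aut_V_over_L"

definition Aut_rep :: "('v \<Rightarrow> 'v) set" where
  "Aut_rep = {\<phi>. bij \<phi> \<and> Vector_Spaces.linear scaleV scaleV \<phi> \<and>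
                 (\<forall>a. \<phi> \<circ> \<rho> a = \<rho> a \<circ> \<phi>) \<and>
                 (\<forall>a b. \<phi> \<circ> D a b = D a b \<circ> \<phi>) \<and>
                 (\<forall>a b. \<phi> \<circ> \<theta> a b = \<theta> a b \<circ> \<phi>)}"

definition Aut_inv :: "('l \<Rightarrow> 'l) set" where
  "Aut_inv = {\<psi> \<in> ly_aut scaleL br tr.
                 (\<forall>a. \<rho> (\<psi> a) = \<rho> a) \<and>
                 (\<forall>a b. D (\<psi> a) (\<psi> b) = D a b) \<and>
                 (\<forall>a b. \<theta> (\<psi> a) (\<psi> b) = \<theta> a b)}"

end

text \<open>A set \<open>H\<close> of bijections of a type, as a group under composition of maps.\<close>

abbreviation bij_group :: "('a \<Rightarrow> 'a) set \<Rightarrow> ('a \<Rightarrow> 'a) monoid" where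
  "bij_group H \<equiv> BijGroup UNIV \<lparr>carrier := H\<rparr>"

text \<open>Outer semi-direct product \<open>H \<ltimes> N\<close> for a left action \<open>\<alpha> : H \<rightarrow> Aut(N)\<close>;
  the normal factor is the second one, and \<open>(h, n)\<close> stands for the product \<open>n h\<close>.\<close>

definition semidirect_group ::
  "('h, 'x) monoid_scheme \<Rightarrow> ('n, 'y) monoid_scheme \<Rightarrow> ('h \<Rightarrow> 'n \<Rightarrow> 'n) \<Rightarrow> ('h \<times> 'n) monoid" where
  "semidirect_group H N \<alpha> =
     \<lparr>carrier = carrier H \<times> carrier N,
      mult = (\<lambda>(h, n) (h', n'). (h \<otimes>\<^bsub>H\<^esub> h', n \<otimes>\<^bsub>N\<^esub> \<alpha> h n')),
      one = (\<one>\<^bsub>H\<^esub>, \<one>\<^bsub>N\<^esub>)\<rparr>"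

text \<open>All sets of maps defined above, and the semi-direct product, are indeed groups;
  the library's \<open>\<cong>\<close> does not assert this by itself.\<close>

lemma subgroup_bijI:
  assumes "\<And>f. f \<in> H \<Longrightarrow> bij f" "id \<in> H"
    and "\<And>f g. f \<in> H \<Longrightarrow> g \<in> H \<Longrightarrow> f \<circ> g \<in> H"
    and "\<And>f. f \<in> H \<Longrightarrow> inv_into UNIV f \<in> H"
  shows "subgroup H (BijGroup UNIV)"
proof -
  have B: "Bij UNIV = {f. bij f}" by (auto simp: Bij_def)
  show ?thesis
  proof (rule subgroup.intro)
    show "H \<subseteq> carrier (BijGroup UNIV)" using assms(1) by (auto simp: BijGroup_def B)
    fix f g assume "f \<in> H" "g \<in> H"
    then show "f \<otimes>\<^bsub>BijGroup UNIV\<^esub> g \<in> H"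
      using assms(1,3)[of f] assms(1)[of g] assms(3)[of f g] by (simp add: BijGroup_def B compose_def o_def restrict_def)
  next
    show "\<one>\<^bsub>BijGroup UNIV\<^esub> \<in> H" using assms(2) by (simp add: BijGroup_def id_def restrict_def)
  next
    fix f assume "f \<in> H"
    then show "inv\<^bsub>BijGroup UNIV\<^esub> f \<in> H"
      using assms(1)[of f] assms(4)[of f] by (simp add: inv_BijGroup B restrict_def)
  qed
qed

lemma group_bij_groupI:
  assumes "\<And>f. f \<in> H \<Longrightarrow> bij f" "id \<in> H"
    and "\<And>f g. f \<in> H \<Longrightarrow> g \<in> H \<Longrightarrow> f \<circ> g \<in> H"
    and "\<And>f. f \<in> H \<Longrightarrow> inv_into UNIV f \<in> H"
  shows "group (bij_group H)"
  using subgroup.subgroup_is_group[OF subgroup_bijI group_BijGroup] assms by blast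

lemma group_semidirect_group:
  assumes "group H" "group N" "\<alpha> \<in> hom H (AutoGroup N)"
  shows "group (semidirect_group H N \<alpha>)"
proof -
  interpret H: group H by fact
  interpret N: group N by fact
  interpret A: group "AutoGroup N" by (rule N.AutoGroup)
  interpret a: group_hom H "AutoGroup N" \<alpha> using assms(3) by unfold_locales
  have aut: "\<alpha> h \<in> auto N" if "h \<in> carrier H" for h
    using a.hom_closed[OF that] by (simp add: AutoGroup_def)
  have cl: "\<alpha> h n \<in> carrier N" if "h \<in> carrier H" "n \<in> carrier N" for h n
    using aut[OF that(1)] that(2) by (auto simp: auto_def hom_def)
  have hm: "\<alpha> h (n \<otimes>\<^bsub>N\<^esub> m) = \<alpha> h n \<otimes>\<^bsub>N\<^esub> \<alpha> h m" if "h \<in> carrier H" "n \<in> carrier N" "m \<in> carrier N" for h n m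
    using aut[OF that(1)] that(2,3) by (auto simp: auto_def hom_def)
  have act: "\<alpha> (h \<otimes>\<^bsub>H\<^esub> k) n = \<alpha> h (\<alpha> k n)" if "h \<in> carrier H" "k \<in> carrier H" "n \<in> carrier N" for h k n
    using a.hom_mult[OF that(1,2)] aut[OF that(1)] aut[OF that(2)] that(3)
    by (simp add: AutoGroup_def BijGroup_def auto_def compose_def)
  have one: "\<alpha> \<one>\<^bsub>H\<^esub> n = n" if "n \<in> carrier N" for n
    using a.hom_one that by (simp add: AutoGroup_def BijGroup_def)
  have inv1: "\<alpha> (inv\<^bsub>H\<^esub> h) (\<alpha> h n) = n" if "h \<in> carrier H" "n \<in> carrier N" for h n
    using act[of "inv\<^bsub>H\<^esub> h" h n] one that by simp
  have aone: "\<alpha> h \<one>\<^bsub>N\<^esub> = \<one>\<^bsub>N\<^esub>" if "h \<in> carrier H" for h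
    using hm[of h "\<one>\<^bsub>N\<^esub>" "\<one>\<^bsub>N\<^esub>"] cl[of h "\<one>\<^bsub>N\<^esub>"] that N.l_cancel_one' by fastforce
  show ?thesis
  proof (rule groupI)
    fix x y assume "x \<in> carrier (semidirect_group H N \<alpha>)" "y \<in> carrier (semidirect_group H N \<alpha>)"
    then show "x \<otimes>\<^bsub>semidirect_group H N \<alpha>\<^esub> y \<in> carrier (semidirect_group H N \<alpha>)"
      by (auto simp: semidirect_group_def cl)
  next
    show "\<one>\<^bsub>semidirect_group H N \<alpha>\<^esub> \<in> carrier (semidirect_group H N \<alpha>)"
      by (simp add: semidirect_group_def)
  next
    fix x y z assume "x \<in> carrier (semidirect_group H N \<alpha>)" "y \<in> carrier (semidirect_group H N \<alpha>)"
      "z \<in> carrier (semidirect_group H N \<alpha>)"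
    then show "x \<otimes>\<^bsub>semidirect_group H N \<alpha>\<^esub> y \<otimes>\<^bsub>semidirect_group H N \<alpha>\<^esub> z =
      x \<otimes>\<^bsub>semidirect_group H N \<alpha>\<^esub> (y \<otimes>\<^bsub>semidirect_group H N \<alpha>\<^esub> z)"
      by (auto simp: semidirect_group_def cl hm act H.m_assoc N.m_assoc simp del: a.hom_mult)
  next
    fix x assume "x \<in> carrier (semidirect_group H N \<alpha>)"
    then show "\<one>\<^bsub>semidirect_group H N \<alpha>\<^esub> \<otimes>\<^bsub>semidirect_group H N \<alpha>\<^esub> x = x"
      by (auto simp: semidirect_group_def one simp del: a.hom_one)
  next
    fix x assume x: "x \<in> carrier (semidirect_group H N \<alpha>)"
    obtain h n where hn: "x = (h, n)" "h \<in> carrier H" "n \<in> carrier N"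
      using x by (auto simp: semidirect_group_def)
    have "(inv\<^bsub>H\<^esub> h, \<alpha> (inv\<^bsub>H\<^esub> h) (inv\<^bsub>N\<^esub> n)) \<otimes>\<^bsub>semidirect_group H N \<alpha>\<^esub> x = \<one>\<^bsub>semidirect_group H N \<alpha>\<^esub>"
      using hn by (simp add: semidirect_group_def aone flip: hm del: a.hom_inv)
    then show "\<exists>y \<in> carrier (semidirect_group H N \<alpha>). y \<otimes>\<^bsub>semidirect_group H N \<alpha>\<^esub> x = \<one>\<^bsub>semidirect_group H N \<alpha>\<^esub>"
      using hn by (intro bexI[of _ "(inv\<^bsub>H\<^esub> h, \<alpha> (inv\<^bsub>H\<^esub> h) (inv\<^bsub>N\<^esub> n))"])
        (simp_all add: semidirect_group_def cl del: a.hom_inv)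
  qed
qed

lemma linear_inv:
  assumes "bij f" "Vector_Spaces.linear s s f" shows "Vector_Spaces.linear s s (inv_into UNIV f)"
proof -
  interpret f: Vector_Spaces.linear s s f by fact
  show ?thesis
    by unfold_locales (metis assms(1) bij_inv_eq_iff f.add f.scale)+
qed

lemma
  fixes s :: "'k::field \<Rightarrow> 'l::ab_group_add \<Rightarrow> 'l"
  assumes "vector_space s"
  shows ly_aut_id: "id \<in> ly_aut s br tr"
    and ly_aut_comp: "\<And>f g. f \<in> ly_aut s br tr \<Longrightarrow> g \<in> ly_aut s br tr \<Longrightarrow> f \<circ> g \<in> ly_aut s br tr"
    and ly_aut_inv: "\<And>f. f \<in> ly_aut s br tr \<Longrightarrow> inv_into UNIV f \<in> ly_aut s br tr"
proof -
  interpret vector_space s by fact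
  show "id \<in> ly_aut s br tr" by (simp add: ly_aut_def linear_id)
  show "f \<circ> g \<in> ly_aut s br tr" if "f \<in> ly_aut s br tr" "g \<in> ly_aut s br tr" for f g
    using that by (auto simp: ly_aut_def bij_comp intro: Vector_Spaces.linear_compose)
  show "inv_into UNIV f \<in> ly_aut s br tr" if "f \<in> ly_aut s br tr" for f
  proof -
    have f: "bij f" "Vector_Spaces.linear s s f" "\<And>a b. f (br a b) = br (f a) (f b)"
       "\<And>a b c. f (tr a b c) = tr (f a) (f b) (f c)" using that by (auto simp: ly_aut_def)
    have "inv_into UNIV f (br a b) = br (inv_into UNIV f a) (inv_into UNIV f b)" for a b
      using bij_inv_eq_iff[OF f(1), of "br (inv_into UNIV f a) (inv_into UNIV f b)" "br a b"] f(1,3)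
      by (simp add: bij_is_surj surj_f_inv_f)
    moreover have "inv_into UNIV f (tr a b c) = tr (inv_into UNIV f a) (inv_into UNIV f b) (inv_into UNIV f c)" for a b c
      using bij_inv_eq_iff[OF f(1), of "tr (inv_into UNIV f a) (inv_into UNIV f b) (inv_into UNIV f c)" "tr a b c"] f(1,4)
      by (simp add: bij_is_surj surj_f_inv_f)
    ultimately show ?thesis using f(1,2) by (simp add: ly_aut_def bij_imp_bij_inv linear_inv)
  qed
qed

context ly_representation begin

lemma vector_space_sd: "vector_space (sd_scale scaleL scaleV)"
  by unfold_locales (auto simp: sd_scale_def L.scale_right_distrib L.scale_left_distrib
      V.scale_right_distrib V.scale_left_distrib)

lemma Aut_V_cl:
  shows Aut_V_bij: "\<And>f. f \<in> Aut_V scaleL br tr scaleV \<rho> D \<theta> \<Longrightarrow> bij f" and Aut_V_id: "id \<in> Aut_V scaleL br tr scaleV \<rho> D \<theta>"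
    and Aut_V_comp: "\<And>f g. f \<in> Aut_V scaleL br tr scaleV \<rho> D \<theta> \<Longrightarrow> g \<in> Aut_V scaleL br tr scaleV \<rho> D \<theta> \<Longrightarrow> f \<circ> g \<in> Aut_V scaleL br tr scaleV \<rho> D \<theta>"
    and Aut_V_inv: "\<And>f. f \<in> Aut_V scaleL br tr scaleV \<rho> D \<theta> \<Longrightarrow> inv_into UNIV f \<in> Aut_V scaleL br tr scaleV \<rho> D \<theta>"
proof -
  note A = ly_aut_id[OF vector_space_sd] ly_aut_comp[OF vector_space_sd] ly_aut_inv[OF vector_space_sd]
  show "bij f" if "f \<in> Aut_V scaleL br tr scaleV \<rho> D \<theta>" for f using that by (auto simp: Aut_V_def ly_aut_def)
  show "id \<in> Aut_V scaleL br tr scaleV \<rho> D \<theta>" by (auto simp: Aut_V_def intro: A)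
  show "f \<circ> g \<in> Aut_V scaleL br tr scaleV \<rho> D \<theta>" if "f \<in> Aut_V scaleL br tr scaleV \<rho> D \<theta>" "g \<in> Aut_V scaleL br tr scaleV \<rho> D \<theta>" for f g
    using that by (auto simp: Aut_V_def simp del: comp_apply intro: A simp: image_comp[symmetric])
  show "inv_into UNIV f \<in> Aut_V scaleL br tr scaleV \<rho> D \<theta>" if "f \<in> Aut_V scaleL br tr scaleV \<rho> D \<theta>" for f
  proof -
    have f: "f \<in> ly_aut (sd_scale scaleL scaleV) (sd_br br \<rho>) (sd_tr tr D \<theta>)" "f ` V_part = V_part"
      using that by (auto simp: Aut_V_def)
    then have "inv_into UNIV f ` V_part = V_part"
      using image_inv_f_f[of f V_part] by (simp add: ly_aut_def bij_is_inj)
    with A(3)[OF f(1)] show ?thesis by (simp add: Aut_V_def)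
  qed
qed

lemma fst_Aut_V: assumes "f \<in> Aut_V scaleL br tr scaleV \<rho> D \<theta>" shows "fst (f (a, u)) = bar f a"
proof -
  interpret f: Vector_Spaces.linear "sd_scale scaleL scaleV" "sd_scale scaleL scaleV" f
    using assms by (auto simp: Aut_V_def ly_aut_def)
  have "f (0, u) \<in> V_part" using assms by (auto simp: Aut_V_def V_part_def)
  moreover have "f (a, u) = f (a, 0) + f (0, u)" by (simp flip: f.add)
  ultimately show ?thesis by (auto simp: V_part_def bar_def)
qed

lemma bar_comp: "f \<in> Aut_V scaleL br tr scaleV \<rho> D \<theta> \<Longrightarrow> bar (f \<circ> g) = bar f \<circ> bar g"
proof (rule ext)
  fix a assume f: "f \<in> Aut_V scaleL br tr scaleV \<rho> D \<theta>"
  obtain b u where g: "g (a, 0) = (b, u)" by fastforce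
  show "bar (f \<circ> g) a = (bar f \<circ> bar g) a" using fst_Aut_V[OF f, of b u] g by (simp add: bar_def)
qed

lemma bar_id: "bar id = id" by (auto simp: bar_def)

lemma bar_inv: assumes "f \<in> Aut_V scaleL br tr scaleV \<rho> D \<theta>" "bar f = id" shows "bar (inv_into UNIV f) = id"
  using bar_comp[OF assms(1), of "inv_into UNIV f"] assms bar_id Aut_V_bij[OF assms(1)]
  by (metis bij_is_surj surj_iff id_comp)

lemma fix_inv: assumes "f \<in> Aut_V scaleL br tr scaleV \<rho> D \<theta>" "\<forall>x \<in> V_part. f x = x" shows "\<forall>x \<in> V_part. inv_into UNIV f x = x"
  using assms bij_is_inj[OF Aut_V_bij[OF assms(1)]] by (metis inv_f_eq)

lemma group_Aut_subgroups: "group (bij_group (Aut_V_over_L scaleL br tr scaleV \<rho> D \<theta>))" "group (bij_group (Aut_fix_V scaleL br tr scaleV \<rho> D \<theta>))" "group (bij_group (Aut_fix_V_over_L scaleL br tr scaleV \<rho> D \<theta>))"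
  by (rule group_bij_groupI;
    auto simp: Aut_V_over_L_def Aut_fix_V_over_L_def Aut_fix_V_def Aut_V_bij Aut_V_id Aut_V_comp Aut_V_inv bar_comp bar_id bar_inv fix_inv[rule_format])+

lemma comm_inv: assumes "bij f" "f \<circ> g = g \<circ> f" shows "inv_into UNIV f \<circ> g = g \<circ> inv_into UNIV f"
proof (rule ext)
  fix x
  have "f (g (inv_into UNIV f x)) = g x"
    using fun_cong[OF assms(2), of "inv_into UNIV f x"] assms(1) by (simp add: bij_is_surj surj_f_inv_f)
  then show "(inv_into UNIV f \<circ> g) x = (g \<circ> inv_into UNIV f) x"
    using bij_is_inj[OF assms(1)] by (simp add: inv_f_eq)
qed

lemma group_Aut_rep: "group (bij_group (Aut_rep scaleV \<rho> D \<theta>))"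
  apply (rule group_bij_groupI)
  apply (auto simp: Aut_rep_def V.linear_id comm_inv linear_inv bij_imp_bij_inv intro: bij_comp Vector_Spaces.linear_compose)[2]
  subgoal for f g unfolding Aut_rep_def 
   by (auto intro: bij_comp Vector_Spaces.linear_compose simp: fun_eq_iff)
  by (auto simp: Aut_rep_def V.linear_id comm_inv linear_inv bij_imp_bij_inv)

lemma group_Aut_inv: "group (bij_group (Aut_inv scaleL br tr \<rho> D \<theta>))"
proof (rule group_bij_groupI)
  note A = ly_aut_id[OF L.vector_space_axioms] ly_aut_comp[OF L.vector_space_axioms] ly_aut_inv[OF L.vector_space_axioms]
  show bij: "bij f" if "f \<in> Aut_inv scaleL br tr \<rho> D \<theta>" for f using that by (simp add: Aut_inv_def ly_aut_def)
  show "id \<in> Aut_inv scaleL br tr \<rho> D \<theta>" by (simp add: Aut_inv_def A)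
  show "f \<circ> g \<in> Aut_inv scaleL br tr \<rho> D \<theta>" if "f \<in> Aut_inv scaleL br tr \<rho> D \<theta>" "g \<in> Aut_inv scaleL br tr \<rho> D \<theta>" for f g
    using that by (simp add: Aut_inv_def A)
  show "inv_into UNIV f \<in> Aut_inv scaleL br tr \<rho> D \<theta>" if f: "f \<in> Aut_inv scaleL br tr \<rho> D \<theta>" for f
  proof -
    have s: "f (inv_into UNIV f a) = a" for a using bij[OF f] by (simp add: bij_is_surj surj_f_inv_f)
    have "\<rho> (f (inv_into UNIV f a)) = \<rho> (inv_into UNIV f a)"
      "D (f (inv_into UNIV f a)) (f (inv_into UNIV f b)) = D (inv_into UNIV f a) (inv_into UNIV f b)"
      "\<theta> (f (inv_into UNIV f a)) (f (inv_into UNIV f b)) = \<theta> (inv_into UNIV f a) (inv_into UNIV f b)" for a b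
      using f unfolding Aut_inv_def by blast+
    then show ?thesis using f unfolding s by (simp add: Aut_inv_def A)
  qed
qed

end
end

theory Submission
  imports Defs "HOL-Algebra.Coset"
begin

text \<open>
  An automorphism \<open>\<gamma>\<close> of \<open>L \<ltimes> V\<close> preserving \<open>V\<close> is block triangular:
  \<open>\<gamma>(a, u) = (\<psi>(a), \<lambda>(a) + \<phi>(u))\<close> with \<open>\<psi> = bar \<gamma>\<close> and \<open>\<phi> = \<gamma>|\<^sub>V\<close>. Both diagonal blocks
  are multiplicative in \<open>\<gamma>\<close>. Since \<open>V\<close> is an abelian ideal, the operations of
  \<open>L \<ltimes> V\<close> with exactly one argument in \<open>V\<close> do not see \<open>\<lambda>\<close>, and they record precisely
  \<open>\<rho>\<close>, \<open>D\<close> and \<open>\<theta>\<close>; hence \<open>\<phi>\<close> intertwines the action of \<open>a\<close> with that of \<open>\<psi>(a)\<close>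
  (\<open>restrict_V_equivariant\<close>). So \<open>\<psi> = id\<close> forces \<open>\<phi>\<close> to be an automorphism of the
  representation, and \<open>\<phi> = id\<close> forces \<open>\<psi>\<close> to leave the representation invariant.

  Conversely, block diagonal maps \<open>\<psi> \<times> \<phi>\<close> satisfying the intertwining relations are automorphisms
  (\<open>map_prod_in_AutV\<close>). Thus \<open>\<gamma> \<mapsto> \<phi>\<close> on the automorphisms over \<open>L\<close>, and \<open>\<gamma> \<mapsto> \<psi>\<close> on
  those fixing \<open>V\<close>, are split epimorphisms onto \<open>Aut\<^sub>r\<^sub>e\<^sub>p(V)\<close> and onto the group of invariant
  automorphisms of \<open>L\<close>. In both cases the kernel consists of the \<open>\<gamma>\<close> with both blocks trivial,
  and a split epimorphism presents its source as a semi-direct product of its target and its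
  kernel, the target acting by conjugation through the splitting
  (\<open>split_epimorphism_imp_semidirect\<close>).
\<close>

section \<open>Split extensions of groups\<close>

text \<open>Every \<open>g\<close> factors uniquely as \<open>n s(h)\<close> with \<open>n\<close> in the kernel, namely for \<open>h = p(g)\<close>; and
  \<open>n s(h) n' s(h') = n (s(h) n' s(h)\<^sup>-\<^sup>1) s(h h')\<close>, so \<open>h\<close> acts by conjugation with \<open>s(h)\<close>.\<close>

lemma split_epimorphism_imp_semidirect:
  assumes "group G" "group H" "p \<in> hom G H" "s \<in> hom H G"
    and ps: "\<And>h. h \<in> carrier H \<Longrightarrow> p (s h) = h"
  shows "\<exists>\<alpha> \<in> hom H (AutoGroup (G\<lparr>carrier := kernel G H p\<rparr>)).
           G \<cong> semidirect_group H (G\<lparr>carrier := kernel G H p\<rparr>) \<alpha>"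
proof -
  interpret G: group G by fact
  interpret H: group H by fact
  interpret p: group_hom G H p using assms(3) by unfold_locales
  interpret s: group_hom H G s using assms(4) by unfold_locales
  let ?K = "kernel G H p"
  let ?N = "G\<lparr>carrier := ?K\<rparr>"
  \<comment> \<open>Conjugation is cut off outside the kernel because elements of \<open>AutoGroup\<close> are extensional.\<close>
  define c where "c g = (\<lambda>n \<in> ?K. g \<otimes>\<^bsub>G\<^esub> n \<otimes>\<^bsub>G\<^esub> inv\<^bsub>G\<^esub> g)" for g
  have K: "n \<in> ?K \<longleftrightarrow> n \<in> carrier G \<and> p n = \<one>\<^bsub>H\<^esub>" for n
    by (auto simp: kernel_def)
  have cancel: "inv\<^bsub>G\<^esub> g \<otimes>\<^bsub>G\<^esub> (g \<otimes>\<^bsub>G\<^esub> x) = x" "g \<otimes>\<^bsub>G\<^esub> (inv\<^bsub>G\<^esub> g \<otimes>\<^bsub>G\<^esub> x) = x"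
    if "g \<in> carrier G" "x \<in> carrier G" for g x
    using that by (simp_all flip: G.m_assoc)
  have c_in: "c g n \<in> ?K" if "g \<in> carrier G" "n \<in> ?K" for g n
    using that by (simp add: c_def K)
  have c_mult: "c g (c h n) = c (g \<otimes>\<^bsub>G\<^esub> h) n" if "g \<in> carrier G" "h \<in> carrier G" "n \<in> ?K" for g h n
    using that c_in[of h n] by (simp add: c_def K G.m_assoc G.inv_mult_group)
  have c_one: "c \<one>\<^bsub>G\<^esub> n = n" if "n \<in> ?K" for n
    using that by (simp add: c_def K)
  have c_hom: "c g (n \<otimes>\<^bsub>G\<^esub> m) = c g n \<otimes>\<^bsub>G\<^esub> c g m" if "g \<in> carrier G" "n \<in> ?K" "m \<in> ?K" for g n m
    using that by (simp add: c_def K G.m_assoc cancel)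
  have c_auto: "c g \<in> auto ?N" if g: "g \<in> carrier G" for g
  proof -
    have "bij_betw (c g) ?K ?K"
      using g c_in[OF g] c_in[of "inv\<^bsub>G\<^esub> g"] c_mult[of "inv\<^bsub>G\<^esub> g" g] c_mult[of g "inv\<^bsub>G\<^esub> g"] c_one
      by (intro bij_betw_byWitness[where f' = "c (inv\<^bsub>G\<^esub> g)"]) auto
    moreover have "c g \<in> extensional ?K" by (simp add: c_def)
    ultimately show ?thesis
      using c_in[OF g] c_hom[OF g] by (auto simp: auto_def Bij_def hom_def)
  qed
  have "(\<lambda>h. c (s h)) \<in> hom H (AutoGroup ?N)"
  proof (rule homI)
    fix h k assume hk: "h \<in> carrier H" "k \<in> carrier H"
    have "c (s h \<otimes>\<^bsub>G\<^esub> s k) = compose ?K (c (s h)) (c (s k))"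
    proof (rule ext)
      fix n
      show "c (s h \<otimes>\<^bsub>G\<^esub> s k) n = compose ?K (c (s h)) (c (s k)) n"
        using hk c_mult[of "s h" "s k" n] by (cases "n \<in> ?K") (auto simp: compose_def c_def)
    qed
    then show "c (s (h \<otimes>\<^bsub>H\<^esub> k)) = c (s h) \<otimes>\<^bsub>AutoGroup ?N\<^esub> c (s k)"
      using hk c_auto[of "s h"] c_auto[of "s k"] by (simp add: AutoGroup_def BijGroup_def auto_def)
  qed (simp add: c_auto AutoGroup_def)
  moreover
  let ?S = "semidirect_group H ?N (\<lambda>h. c (s h))"
  define f where "f = (\<lambda>g. (p g, g \<otimes>\<^bsub>G\<^esub> inv\<^bsub>G\<^esub> (s (p g))))"
  have carS: "carrier ?S = carrier H \<times> ?K" by (simp add: semidirect_group_def)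
  have f_in: "g \<otimes>\<^bsub>G\<^esub> inv\<^bsub>G\<^esub> (s (p g)) \<in> ?K" if "g \<in> carrier G" for g
    using that by (simp add: K ps)
  have "f \<in> iso G ?S"
  proof (rule isoI)
    show "f \<in> hom G ?S"
    proof (rule homI)
      show "f g \<in> carrier ?S" if "g \<in> carrier G" for g
        using that f_in[OF that] by (simp add: carS f_def)
      show "f (g \<otimes>\<^bsub>G\<^esub> g') = f g \<otimes>\<^bsub>?S\<^esub> f g'" if "g \<in> carrier G" "g' \<in> carrier G" for g g'
        using that f_in[of g'] by (simp add: f_def semidirect_group_def c_def G.m_assoc G.inv_mult_group
            cancel del: p.hom_inv s.hom_inv)
    qed
    show "bij_betw f (carrier G) (carrier ?S)"
      by (rule bij_betw_byWitness[where f' = "\<lambda>(h, n). n \<otimes>\<^bsub>G\<^esub> s h"])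
        (auto simp: f_def carS K ps G.m_assoc)
  qed
  then have "G \<cong> ?S" by (rule is_isoI)
  ultimately show ?thesis by blast
qed

lemma bij_group_mult:
  assumes "bij f" "bij g"
  shows "f \<otimes>\<^bsub>bij_group H\<^esub> g = f \<circ> g"
  using assms by (simp add: BijGroup_def Bij_def compose_def o_def restrict_def)

lemma bij_group_one: "\<one>\<^bsub>bij_group H\<^esub> = id"
  by (simp add: BijGroup_def id_def restrict_def)

text \<open>The same for groups of bijections, with all conditions phrased by composition of maps.\<close>

lemma split_bij_group_imp_semidirect:
  assumes G: "group (bij_group G)" "\<And>f. f \<in> G \<Longrightarrow> bij f"
    and H: "group (bij_group H)" "\<And>h. h \<in> H \<Longrightarrow> bij h"
    and p: "\<And>f. f \<in> G \<Longrightarrow> p f \<in> H"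
      "\<And>f g. f \<in> G \<Longrightarrow> g \<in> G \<Longrightarrow> p (f \<circ> g) = p f \<circ> p g"
    and s: "\<And>h. h \<in> H \<Longrightarrow> s h \<in> G"
      "\<And>h k. h \<in> H \<Longrightarrow> k \<in> H \<Longrightarrow> s (h \<circ> k) = s h \<circ> s k"
    and ps: "\<And>h. h \<in> H \<Longrightarrow> p (s h) = h"
    and N: "N = {f \<in> G. p f = id}"
  shows "\<exists>\<alpha> \<in> hom (bij_group H) (AutoGroup (bij_group N)).
           bij_group G \<cong> semidirect_group (bij_group H) (bij_group N) \<alpha>"
proof -
  have "p \<in> hom (bij_group G) (bij_group H)"
    using bij_group_mult[OF G(2) G(2)] bij_group_mult[OF H(2) H(2)] p by (intro homI) auto
  moreover have "s \<in> hom (bij_group H) (bij_group G)"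
    using bij_group_mult[OF G(2) G(2)] bij_group_mult[OF H(2) H(2)] s by (intro homI) auto
  moreover have "(bij_group G)\<lparr>carrier := kernel (bij_group G) (bij_group H) p\<rparr> = bij_group N"
    by (simp add: kernel_def bij_group_one N)
  ultimately show ?thesis
    using split_epimorphism_imp_semidirect[OF G(1) H(1), of p s] ps by simp
qed

section \<open>Diagonal blocks of the automorphisms preserving \<open>V\<close>\<close>

definition restrict_V :: "('l::zero \<times> 'v \<Rightarrow> 'l \<times> 'v) \<Rightarrow> 'v \<Rightarrow> 'v" where
  "restrict_V \<gamma> u = snd (\<gamma> (0, u))"

lemma bar_map_prod: "bar (map_prod \<psi> \<phi>) = \<psi>"
  by (auto simp: bar_def)

lemma restrict_V_map_prod: "\<psi> 0 = 0 \<Longrightarrow> restrict_V (map_prod \<psi> \<phi>) = \<phi>"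
  by (auto simp: restrict_V_def)

lemma linear_zero: "Vector_Spaces.linear s t f \<Longrightarrow> f 0 = 0"
  by (rule module_hom.zero[OF Vector_Spaces.linear.axioms(3)])

lemma bilinear_map_zero:
  assumes "bilinear_map s1 s2 s3 f"
  shows "f 0 y = 0" "f x 0 = 0"
  using assms linear_zero[of s1 s3 "\<lambda>x. f x y"] linear_zero[of s2 s3 "f x"]
  by (simp_all add: bilinear_map_def)

lemma trilinear_map_zero:
  assumes "trilinear_map s1 s2 s3 s4 f"
  shows "f 0 y z = 0" "f x 0 z = 0" "f x y 0 = 0"
  using assms linear_zero[of s1 s4 "\<lambda>x. f x y z"] linear_zero[of s2 s4 "\<lambda>y. f x y z"]
    linear_zero[of s3 s4 "f x y"]
  by (simp_all add: trilinear_map_def)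

context ly_representation begin

abbreviation "AutV \<equiv> Aut_V scaleL br tr scaleV \<rho> D \<theta>"

lemmas zero_arguments =
  bilinear_map_zero[OF L.br_bilinear] trilinear_map_zero[OF L.tr_trilinear]
  bilinear_map_zero[OF rho_linear] trilinear_map_zero[OF D_bilinear]
  trilinear_map_zero[OF theta_bilinear]

lemma AutV_linear:
  "\<gamma> \<in> AutV \<Longrightarrow> Vector_Spaces.linear (sd_scale scaleL scaleV) (sd_scale scaleL scaleV) \<gamma>"
  by (simp add: Aut_V_def ly_aut_def)

text \<open>As \<open>V\<close> is preserved, \<open>restrict_V \<gamma>\<close> loses no information about \<open>\<gamma>\<close> on \<open>V\<close>.\<close>

lemma AutV_on_V:
  assumes "\<gamma> \<in> AutV"
  shows "\<gamma> (0, u) = (0, restrict_V \<gamma> u)"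
proof -
  have "\<gamma> (0, u) \<in> V_part" using assms by (auto simp: Aut_V_def V_part_def)
  then show ?thesis by (auto simp: V_part_def restrict_V_def)
qed

lemma restrict_V_comp:
  "g \<in> AutV \<Longrightarrow> restrict_V (f \<circ> g) = restrict_V f \<circ> restrict_V g"
  by (rule ext) (simp add: AutV_on_V restrict_V_def[of f] restrict_V_def[of "f \<circ> g"])

lemma restrict_V_id: "restrict_V id = id"
  by (auto simp: restrict_V_def)

text \<open>The two diagonal blocks of \<open>\<gamma>\<close> are bijective because those of \<open>\<gamma>\<^sup>-\<^sup>1\<close> are their inverses.\<close>

lemma AutV_inverse: "\<gamma> \<in> AutV \<Longrightarrow> inv_into UNIV \<gamma> \<circ> \<gamma> = id" "\<gamma> \<in> AutV \<Longrightarrow> \<gamma> \<circ> inv_into UNIV \<gamma> = id"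
  using Aut_V_bij[of \<gamma>] by (simp_all add: bij_is_inj bij_is_surj flip: surj_iff)

lemma bij_restrict_V: "\<gamma> \<in> AutV \<Longrightarrow> bij (restrict_V \<gamma>)"
  using Aut_V_inv[of \<gamma>]
  by (intro o_bij[of "restrict_V (inv_into UNIV \<gamma>)"])
    (simp_all add: AutV_inverse restrict_V_id flip: restrict_V_comp)

lemma bij_bar: "\<gamma> \<in> AutV \<Longrightarrow> bij (bar \<gamma>)"
  using Aut_V_inv[of \<gamma>]
  by (intro o_bij[of "bar (inv_into UNIV \<gamma>)"]) (simp_all add: AutV_inverse bar_id flip: bar_comp)

lemma linear_restrict_V:
  assumes "\<gamma> \<in> AutV" shows "Vector_Spaces.linear scaleV scaleV (restrict_V \<gamma>)"
proof -
  interpret \<gamma>: Vector_Spaces.linear "sd_scale scaleL scaleV" "sd_scale scaleL scaleV" \<gamma>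
    using assms by (rule AutV_linear)
  show ?thesis
  proof unfold_locales
    show "restrict_V \<gamma> (u + v) = restrict_V \<gamma> u + restrict_V \<gamma> v" for u v
      using \<gamma>.add[of "(0, u)" "(0, v)"] by (simp add: restrict_V_def)
    show "restrict_V \<gamma> (scaleV k u) = scaleV k (restrict_V \<gamma> u)" for k u
      using \<gamma>.scale[of k "(0, u)"] by (simp add: AutV_on_V[OF assms] sd_scale_def)
  qed
qed

lemma linear_bar:
  assumes "\<gamma> \<in> AutV" shows "Vector_Spaces.linear scaleL scaleL (bar \<gamma>)"
proof -
  interpret \<gamma>: Vector_Spaces.linear "sd_scale scaleL scaleV" "sd_scale scaleL scaleV" \<gamma>
    using assms by (rule AutV_linear)
  show ?thesis
  proof unfold_locales
    show "bar \<gamma> (a + b) = bar \<gamma> a + bar \<gamma> b" for a b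
      using \<gamma>.add[of "(a, 0)" "(b, 0)"] by (simp add: bar_def)
    show "bar \<gamma> (scaleL k a) = scaleL k (bar \<gamma> a)" for k a
      using arg_cong[OF \<gamma>.scale[of k "(a, 0)"], of fst]
      by (simp add: bar_def sd_scale_def split: prod.splits)
  qed
qed

lemma AutV_br: "\<gamma> \<in> AutV \<Longrightarrow> \<gamma> (sd_br br \<rho> x y) = sd_br br \<rho> (\<gamma> x) (\<gamma> y)"
  and AutV_tr: "\<gamma> \<in> AutV \<Longrightarrow> \<gamma> (sd_tr tr D \<theta> x y z) = sd_tr tr D \<theta> (\<gamma> x) (\<gamma> y) (\<gamma> z)"
  unfolding Aut_V_def ly_aut_def by blast+

lemma bar_in_ly_aut:
  assumes "\<gamma> \<in> AutV" shows "bar \<gamma> \<in> ly_aut scaleL br tr"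
proof -
  have "bar \<gamma> (br a b) = br (bar \<gamma> a) (bar \<gamma> b)" for a b
    using arg_cong[OF AutV_br[OF assms, of "(a, 0)" "(b, 0)"], of fst]
    by (simp add: sd_br_def fst_Aut_V[OF assms] case_prod_unfold)
  moreover have "bar \<gamma> (tr a b c) = tr (bar \<gamma> a) (bar \<gamma> b) (bar \<gamma> c)" for a b c
    using arg_cong[OF AutV_tr[OF assms, of "(a, 0)" "(b, 0)" "(c, 0)"], of fst]
    by (simp add: sd_tr_def fst_Aut_V[OF assms] case_prod_unfold)
  ultimately show ?thesis using assms by (simp add: ly_aut_def bij_bar linear_bar)
qed

text \<open>\<open>\<rho>(a)v\<close>, \<open>D(a,b)v\<close> and \<open>\<theta>(a,b)v\<close> are the operations \<open>[a,v]\<close>, \<open>{a,b,v}\<close> and \<open>{v,a,b}\<close> of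
  \<open>L \<ltimes> V\<close>. Apply \<open>\<gamma>\<close>: the \<open>V\<close>-components of \<open>\<gamma>(a)\<close> and \<open>\<gamma>(b)\<close> contribute nothing, since
  operations with two arguments in \<open>V\<close> vanish.\<close>

lemma restrict_V_equivariant:
  assumes "\<gamma> \<in> AutV"
  shows "restrict_V \<gamma> (\<rho> a v) = \<rho> (bar \<gamma> a) (restrict_V \<gamma> v)"
    and "restrict_V \<gamma> (D a b v) = D (bar \<gamma> a) (bar \<gamma> b) (restrict_V \<gamma> v)"
    and "restrict_V \<gamma> (\<theta> a b v) = \<theta> (bar \<gamma> a) (bar \<gamma> b) (restrict_V \<gamma> v)"
proof -
  \<comment> \<open>\<open>l\<close> is the off-diagonal block, which drops out of every computation below.\<close>
  obtain l where "\<And>a. \<gamma> (a, 0) = (bar \<gamma> a, l a)"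
    using fst_Aut_V[OF assms, of _ 0] by (intro that[of "\<lambda>a. snd (\<gamma> (a, 0))"]) (simp add: prod_eq_iff)
  note block = this AutV_on_V[OF assms] zero_arguments
  show "restrict_V \<gamma> (\<rho> a v) = \<rho> (bar \<gamma> a) (restrict_V \<gamma> v)"
    using AutV_br[OF assms, of "(a, 0)" "(0, v)"] by (simp add: sd_br_def block)
  show "restrict_V \<gamma> (D a b v) = D (bar \<gamma> a) (bar \<gamma> b) (restrict_V \<gamma> v)"
    using AutV_tr[OF assms, of "(a, 0)" "(b, 0)" "(0, v)"] by (simp add: sd_tr_def block)
  show "restrict_V \<gamma> (\<theta> a b v) = \<theta> (bar \<gamma> a) (bar \<gamma> b) (restrict_V \<gamma> v)"
    using AutV_tr[OF assms, of "(0, v)" "(a, 0)" "(b, 0)"] by (simp add: sd_tr_def block)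
qed

text \<open>The converse of the equivariance above; it supplies the splittings \<open>\<phi> \<mapsto> id \<times> \<phi>\<close> and
  \<open>\<psi> \<mapsto> \<psi> \<times> id\<close>.\<close>

lemma map_prod_in_AutV:
  assumes \<psi>: "\<psi> \<in> ly_aut scaleL br tr"
    and \<phi>: "bij \<phi>" "Vector_Spaces.linear scaleV scaleV \<phi>"
    and rho: "\<And>a v. \<phi> (\<rho> a v) = \<rho> (\<psi> a) (\<phi> v)"
    and D: "\<And>a b v. \<phi> (D a b v) = D (\<psi> a) (\<psi> b) (\<phi> v)"
    and theta: "\<And>a b v. \<phi> (\<theta> a b v) = \<theta> (\<psi> a) (\<psi> b) (\<phi> v)"
  shows "map_prod \<psi> \<phi> \<in> AutV"
proof -
  interpret \<phi>: Vector_Spaces.linear scaleV scaleV \<phi> by fact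
  interpret \<psi>: Vector_Spaces.linear scaleL scaleL \<psi> using \<psi> by (simp add: ly_aut_def)
  interpret sd: vector_space "sd_scale scaleL scaleV" by (rule vector_space_sd)
  have "bij (map_prod \<psi> \<phi>)"
    using \<psi> \<phi>(1) by (simp add: ly_aut_def bij_def prod.inj_map map_prod_surj)
  moreover have "Vector_Spaces.linear (sd_scale scaleL scaleV) (sd_scale scaleL scaleV) (map_prod \<psi> \<phi>)"
    by unfold_locales (auto simp: sd_scale_def \<phi>.add \<psi>.add \<phi>.scale \<psi>.scale)
  moreover have "map_prod \<psi> \<phi> (sd_br br \<rho> x y) = sd_br br \<rho> (map_prod \<psi> \<phi> x) (map_prod \<psi> \<phi> y)" for x y
    using \<psi> by (cases x; cases y) (simp add: ly_aut_def sd_br_def \<phi>.diff rho)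
  moreover have "map_prod \<psi> \<phi> (sd_tr tr D \<theta> x y z)
      = sd_tr tr D \<theta> (map_prod \<psi> \<phi> x) (map_prod \<psi> \<phi> y) (map_prod \<psi> \<phi> z)" for x y z
    using \<psi> by (cases x; cases y; cases z) (simp add: ly_aut_def sd_tr_def \<phi>.diff \<phi>.add D theta)
  moreover have "map_prod \<psi> \<phi> ` V_part = V_part"
    using bij_is_surj[OF \<phi>(1)] by (simp add: V_part_def map_prod_surj_on \<psi>.zero)
  ultimately show ?thesis by (simp add: Aut_V_def ly_aut_def)
qed

section \<open>The two semi-direct decompositions\<close>

lemma Aut_fix_V_iff: "\<gamma> \<in> Aut_fix_V scaleL br tr scaleV \<rho> D \<theta> \<longleftrightarrow> \<gamma> \<in> AutV \<and> restrict_V \<gamma> = id"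
  by (auto simp: Aut_fix_V_def V_part_def AutV_on_V fun_eq_iff)

lemma restrict_V_in_Aut_rep:
  assumes "\<gamma> \<in> Aut_V_over_L scaleL br tr scaleV \<rho> D \<theta>"
  shows "restrict_V \<gamma> \<in> Aut_rep scaleV \<rho> D \<theta>"
  using assms bij_restrict_V[of \<gamma>] linear_restrict_V[of \<gamma>] restrict_V_equivariant[of \<gamma>]
  by (simp add: Aut_V_over_L_def Aut_rep_def fun_eq_iff)

lemma map_prod_id_in_Aut_V_over_L:
  assumes "\<phi> \<in> Aut_rep scaleV \<rho> D \<theta>"
  shows "map_prod id \<phi> \<in> Aut_V_over_L scaleL br tr scaleV \<rho> D \<theta>"
  using assms ly_aut_id[OF L.vector_space_axioms]
  by (auto simp: Aut_V_over_L_def Aut_rep_def bar_map_prod fun_eq_iff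
      intro!: map_prod_in_AutV)

lemma bar_in_Aut_inv:
  assumes "\<gamma> \<in> Aut_fix_V scaleL br tr scaleV \<rho> D \<theta>"
  shows "bar \<gamma> \<in> Aut_inv scaleL br tr \<rho> D \<theta>"
  using assms bar_in_ly_aut[of \<gamma>] restrict_V_equivariant[of \<gamma>]
  by (simp add: Aut_fix_V_iff Aut_inv_def fun_eq_iff)

lemma map_prod_id_in_Aut_fix_V:
  assumes "\<psi> \<in> Aut_inv scaleL br tr \<rho> D \<theta>"
  shows "map_prod \<psi> id \<in> Aut_fix_V scaleL br tr scaleV \<rho> D \<theta>"
proof -
  have \<psi>: "\<psi> \<in> ly_aut scaleL br tr" using assms by (simp add: Aut_inv_def)
  then interpret \<psi>: Vector_Spaces.linear scaleL scaleL \<psi> by (simp add: ly_aut_def)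
  have "map_prod \<psi> id \<in> AutV"
    using assms \<psi> by (intro map_prod_in_AutV) (simp_all add: Aut_inv_def V.linear_id)
  then show ?thesis by (simp add: Aut_fix_V_iff restrict_V_map_prod \<psi>.zero)
qed

lemma Aut_V_over_L_semidirect:
  "\<exists>\<alpha> \<in> hom (bij_group (Aut_rep scaleV \<rho> D \<theta>)) (AutoGroup (bij_group (Aut_fix_V_over_L scaleL br tr scaleV \<rho> D \<theta>))).
     bij_group (Aut_V_over_L scaleL br tr scaleV \<rho> D \<theta>)
       \<cong> semidirect_group (bij_group (Aut_rep scaleV \<rho> D \<theta>))
           (bij_group (Aut_fix_V_over_L scaleL br tr scaleV \<rho> D \<theta>)) \<alpha>"
proof (rule split_bij_group_imp_semidirect[where p = restrict_V and s = "map_prod id"])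
  show "group (bij_group (Aut_V_over_L scaleL br tr scaleV \<rho> D \<theta>))"
    by (rule group_Aut_subgroups)
  show "group (bij_group (Aut_rep scaleV \<rho> D \<theta>))"
    by (rule group_Aut_rep)
  show "bij f" if "f \<in> Aut_V_over_L scaleL br tr scaleV \<rho> D \<theta>" for f
    using that by (simp add: Aut_V_over_L_def Aut_V_bij)
  show "bij h" if "h \<in> Aut_rep scaleV \<rho> D \<theta>" for h
    using that by (simp add: Aut_rep_def)
  show "restrict_V (f \<circ> g) = restrict_V f \<circ> restrict_V g"
    if "g \<in> Aut_V_over_L scaleL br tr scaleV \<rho> D \<theta>" for f g
    using that by (simp add: Aut_V_over_L_def restrict_V_comp)
  show "map_prod id (h \<circ> k) = map_prod id h \<circ> map_prod id k" for h k :: "'v \<Rightarrow> 'v"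
    by (simp add: map_prod.comp)
  show "Aut_fix_V_over_L scaleL br tr scaleV \<rho> D \<theta>
      = {f \<in> Aut_V_over_L scaleL br tr scaleV \<rho> D \<theta>. restrict_V f = id}"
    by (auto simp: Aut_fix_V_over_L_def Aut_fix_V_iff Aut_V_over_L_def)
qed (simp_all add: restrict_V_in_Aut_rep map_prod_id_in_Aut_V_over_L restrict_V_map_prod)

lemma Aut_fix_V_semidirect:
  "\<exists>\<beta> \<in> hom (bij_group (Aut_inv scaleL br tr \<rho> D \<theta>)) (AutoGroup (bij_group (Aut_fix_V_over_L scaleL br tr scaleV \<rho> D \<theta>))).
     bij_group (Aut_fix_V scaleL br tr scaleV \<rho> D \<theta>)
       \<cong> semidirect_group (bij_group (Aut_inv scaleL br tr \<rho> D \<theta>))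
           (bij_group (Aut_fix_V_over_L scaleL br tr scaleV \<rho> D \<theta>)) \<beta>"
proof (rule split_bij_group_imp_semidirect[where p = bar and s = "\<lambda>\<psi>. map_prod \<psi> id"])
  show "group (bij_group (Aut_fix_V scaleL br tr scaleV \<rho> D \<theta>))"
    by (rule group_Aut_subgroups)
  show "group (bij_group (Aut_inv scaleL br tr \<rho> D \<theta>))"
    by (rule group_Aut_inv)
  show "bij f" if "f \<in> Aut_fix_V scaleL br tr scaleV \<rho> D \<theta>" for f
    using that by (simp add: Aut_fix_V_iff Aut_V_bij)
  show "bij h" if "h \<in> Aut_inv scaleL br tr \<rho> D \<theta>" for h
    using that by (simp add: Aut_inv_def ly_aut_def)
  show "bar (f \<circ> g) = bar f \<circ> bar g"
    if "f \<in> Aut_fix_V scaleL br tr scaleV \<rho> D \<theta>" for f g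
    using that by (simp add: Aut_fix_V_iff bar_comp)
  show "map_prod (h \<circ> k) id = map_prod h id \<circ> map_prod k id" for h k :: "'l \<Rightarrow> 'l"
    by (simp add: map_prod.comp)
  show "Aut_fix_V_over_L scaleL br tr scaleV \<rho> D \<theta>
      = {f \<in> Aut_fix_V scaleL br tr scaleV \<rho> D \<theta>. bar f = id}"
    by (auto simp: Aut_fix_V_over_L_def Aut_fix_V_iff Aut_V_over_L_def)
qed (simp_all add: bar_in_Aut_inv map_prod_id_in_Aut_fix_V bar_map_prod)

end

theorem theorem5p8:
  fixes scaleL :: "'k::field_char_0 \<Rightarrow> 'l::ab_group_add \<Rightarrow> 'l"
    and br :: "'l \<Rightarrow> 'l \<Rightarrow> 'l"
    and tr :: "'l \<Rightarrow> 'l \<Rightarrow> 'l \<Rightarrow> 'l"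
    and scaleV :: "'k \<Rightarrow> 'v::ab_group_add \<Rightarrow> 'v"
    and \<rho> :: "'l \<Rightarrow> 'v \<Rightarrow> 'v"
    and D :: "'l \<Rightarrow> 'l \<Rightarrow> 'v \<Rightarrow> 'v"
    and \<theta> :: "'l \<Rightarrow> 'l \<Rightarrow> 'v \<Rightarrow> 'v"
  assumes "lie_yamaguti_algebra scaleL br tr"
    and "ly_representation scaleL br tr scaleV \<rho> D \<theta>"
  shows "(\<exists>\<alpha> \<in> hom (bij_group (Aut_rep scaleV \<rho> D \<theta>)) (AutoGroup (bij_group (Aut_fix_V_over_L scaleL br tr scaleV \<rho> D \<theta>))).
            bij_group (Aut_V_over_L scaleL br tr scaleV \<rho> D \<theta>)
              \<cong> semidirect_group (bij_group (Aut_rep scaleV \<rho> D \<theta>))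
                  (bij_group (Aut_fix_V_over_L scaleL br tr scaleV \<rho> D \<theta>)) \<alpha>) \<and>
         (\<exists>\<beta> \<in> hom (bij_group (Aut_inv scaleL br tr \<rho> D \<theta>)) (AutoGroup (bij_group (Aut_fix_V_over_L scaleL br tr scaleV \<rho> D \<theta>))).
            bij_group (Aut_fix_V scaleL br tr scaleV \<rho> D \<theta>)
              \<cong> semidirect_group (bij_group (Aut_inv scaleL br tr \<rho> D \<theta>))
                  (bij_group (Aut_fix_V_over_L scaleL br tr scaleV \<rho> D \<theta>)) \<beta>)"
  using ly_representation.Aut_V_over_L_semidirect[OF assms(2)]
    ly_representation.Aut_fix_V_semidirect[OF assms(2)]
  by blast

end
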